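(* Let $Q$ be an odd quadrangulation of a non-orientable surface and let $T(Q)$ be its face subdivision. Then the local chromatic number of $T(Q)$ is at least five.
   Context: A surface is a compact connected 2-manifold without boundary. A quadrangulation of a surface is a (finite) loopless graph embedded on the surface such that all faces are quadrilaterals; parallel edges are allowed, and quadrilateral faces may have some of their vertices or even edges coinciding. Odd and even quadrangulations: choose an arbitrary orientation of each face, viewed as a closed walk along its boundary. Consistency is not broken at an edge if the edge is traversed in opposite directions when considering the faces at its two sides; otherwise the edge breaks consistency. The parity of the number of edges breaking consistency does not depend on the chosen orientations of the faces; the quadrangulation is called odd or even according to this parity. The face subdivision $T(Q)$ of a quadrangulation $Q$ is the triangulation of the same surface obtained from $Q$ by adding a new vertex in each face and joining it to the four vertices on the boundary of that face. For a vertex $v$ of a graph $G$, $N(v)$ denotes the set of vertices adjacent to $v$. For an integer $k\ge 1$, a proper vertex-coloring $c$ of $G$ is a local $k$-coloring if $|c(N(v))|\le k-1$ for every vertex $v$ of $G$ (the total number of colors used is not restricted). The local chromatic number $\psi(G)$ is the smallest $k$ such that $G$ has a local $k$-coloring. *)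

theory Defs
  imports "HOL-Homology.Homology"
begin

section \<open>Surfaces\<close>

text \<open>Second countability is not listed: it follows from compactness and the local charts.\<close>

definition surface :: "'a topology \<Rightarrow> bool" where
  "surface S \<longleftrightarrow>
     topspace S \<noteq> {} \<and> compact_space S \<and> connected_space S \<and> Hausdorff_space S \<and>
     (\<forall>x\<in>topspace S. \<exists>U. openin S U \<and> x \<in> U \<and>
        subtopology S U homeomorphic_space (euclidean :: (real^2) topology))"

text \<open>
  A surface is orientable if one can choose, for every point \<open>x\<close>, a generator \<open>\<mu> x\<close> of the
  local homology group \<open>H\<^sub>2(S, S - {x})\<close> (an infinite cyclic group) in a locally consistent way:
  near each point, all the \<open>\<mu> y\<close> are images of one class.
\<close>

definition local_homology :: "'a topology \<Rightarrow> 'a set \<Rightarrow> 'a chain set monoid" where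
  "local_homology S A = relative_homology_group 2 S (topspace S - A)"

definition orientable :: "'a topology \<Rightarrow> bool" where
  "orientable S \<longleftrightarrow>
     (\<exists>\<mu>.
        (\<forall>x\<in>topspace S. \<mu> x \<in> carrier (local_homology S {x}) \<and>
           carrier (local_homology S {x}) = generate (local_homology S {x}) {\<mu> x}) \<and>
        (\<forall>x\<in>topspace S. \<exists>U \<alpha>. openin S U \<and> x \<in> U \<and> \<alpha> \<in> carrier (local_homology S U) \<and>
           (\<forall>y\<in>U. hom_induced 2 S (topspace S - U) S (topspace S - {y}) id \<alpha> = \<mu> y)))"


section \<open>Graphs embedded on a surface\<close>

text \<open>
  The vertices are points and the edges are arcs, taken as point sets. An arc has two distinct ends,
  so there are no loops; parallel edges are different arcs with the same ends. The ends of an edge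
  \<open>e\<close> are the points of \<open>e \<inter> Verts Q\<close>.
\<close>

record 'a embedded_graph =
  Verts :: "'a set"
  Edges :: "'a set set"

definition arc_between :: "'a topology \<Rightarrow> 'a \<Rightarrow> 'a \<Rightarrow> 'a set \<Rightarrow> bool" where
  "arc_between S a b e \<longleftrightarrow>
     (\<exists>g. pathin S g \<and> inj_on g {0..1} \<and> g 0 = a \<and> g 1 = b \<and> e = g ` {0..1})"

definition embedded_on :: "'a topology \<Rightarrow> 'a embedded_graph \<Rightarrow> bool" where
  "embedded_on S Q \<longleftrightarrow>
     finite (Verts Q) \<and> Verts Q \<subseteq> topspace S \<and> finite (Edges Q) \<and>
     (\<forall>e\<in>Edges Q. \<exists>a b. arc_between S a b e \<and> e \<inter> Verts Q = {a, b}) \<and>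
     (\<forall>e\<in>Edges Q. \<forall>e'\<in>Edges Q. e \<noteq> e' \<longrightarrow> e \<inter> e' \<subseteq> Verts Q)"

definition faces :: "'a topology \<Rightarrow> 'a embedded_graph \<Rightarrow> 'a set set" where
  "faces S Q =
     connected_components_of (subtopology S (topspace S - (Verts Q \<union> \<Union>(Edges Q))))"


section \<open>Quadrangulations\<close>

text \<open>
  The model quadrilateral is the closed unit disc with corners \<open>1, \<i>, -1, -\<i>\<close>; its \<open>i\<close>-th side is
  the quarter of the unit circle from corner \<open>i\<close> to corner \<open>i + 1\<close>, and corner \<open>4\<close> is corner \<open>0\<close>.
\<close>

definition corner :: "nat \<Rightarrow> complex" where
  "corner i = cis (real i * pi / 2)"

definition side :: "nat \<Rightarrow> complex set" where
  "side i = cis ` {real i * pi / 2 .. real (Suc i) * pi / 2}"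

text \<open>
  A face \<open>F\<close> is a quadrilateral if it is an open disc whose boundary is a closed walk with four
  edges, as witnessed by a map \<open>\<phi>\<close> of the closed disc: it is a homeomorphism onto \<open>F\<close> inside the
  disc and a bijection from every side onto an edge. It may identify corners or whole sides with each
  other. The map also fixes an orientation of the face: it runs through the boundary as the closed
  walk \<open>\<phi> (corner 0), \<dots>, \<phi> (corner 4)\<close> along the edges \<open>\<phi> ` side 0, \<dots>, \<phi> ` side 3\<close>.
\<close>

definition quad_map :: "'a topology \<Rightarrow> 'a embedded_graph \<Rightarrow> 'a set \<Rightarrow> (complex \<Rightarrow> 'a) \<Rightarrow> bool" where
  "quad_map S Q F \<phi> \<longleftrightarrow>
     continuous_map (top_of_set (cball 0 1)) S \<phi> \<and>
     homeomorphic_map (top_of_set (ball 0 1)) (subtopology S F) \<phi> \<and>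
     (\<forall>i<4. \<phi> (corner i) \<in> Verts Q \<and> inj_on \<phi> (side i) \<and> \<phi> ` side i \<in> Edges Q)"

definition quadrangulation :: "'a topology \<Rightarrow> 'a embedded_graph \<Rightarrow> bool" where
  "quadrangulation S Q \<longleftrightarrow> embedded_on S Q \<and> (\<forall>F\<in>faces S Q. \<exists>\<phi>. quad_map S Q F \<phi>)"

text \<open>
  An orientation of the faces is given by a choice of a map \<open>\<Phi> F\<close> for every face \<open>F\<close>. The pairs
  \<open>(F, i)\<close> in \<open>edge_sides S Q \<Phi> e\<close> are the occurrences of \<open>e\<close> on the boundary walks, that is, the two
  sides of \<open>e\<close>; both may belong to the same face. As the ends of an edge are distinct, the
  direction in which it is traversed is determined by where the traversal starts and ends.
\<close>

definition face_orientation ::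
  "'a topology \<Rightarrow> 'a embedded_graph \<Rightarrow> ('a set \<Rightarrow> complex \<Rightarrow> 'a) \<Rightarrow> bool" where
  "face_orientation S Q \<Phi> \<longleftrightarrow> (\<forall>F\<in>faces S Q. quad_map S Q F (\<Phi> F))"

definition edge_sides ::
  "'a topology \<Rightarrow> 'a embedded_graph \<Rightarrow> ('a set \<Rightarrow> complex \<Rightarrow> 'a) \<Rightarrow> 'a set \<Rightarrow> ('a set \<times> nat) set" where
  "edge_sides S Q \<Phi> e = {(F, i). F \<in> faces S Q \<and> i < 4 \<and> \<Phi> F ` side i = e}"

definition consistent_at ::
  "'a topology \<Rightarrow> 'a embedded_graph \<Rightarrow> ('a set \<Rightarrow> complex \<Rightarrow> 'a) \<Rightarrow> 'a set \<Rightarrow> bool" where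
  "consistent_at S Q \<Phi> e \<longleftrightarrow>
     (\<forall>(F, i) \<in> edge_sides S Q \<Phi> e. \<forall>(G, j) \<in> edge_sides S Q \<Phi> e. (F, i) \<noteq> (G, j) \<longrightarrow>
        \<Phi> F (corner i) = \<Phi> G (corner (Suc j)) \<and> \<Phi> F (corner (Suc i)) = \<Phi> G (corner j))"

text \<open>
  For a quadrangulation of a surface the parity below does not depend on \<open>\<Phi>\<close>, so it makes no
  difference whether \<open>\<Phi>\<close> is quantified existentially or universally.
\<close>

definition odd_quadrangulation :: "'a topology \<Rightarrow> 'a embedded_graph \<Rightarrow> bool" where
  "odd_quadrangulation S Q \<longleftrightarrow> quadrangulation S Q \<and>
     (\<exists>\<Phi>. face_orientation S Q \<Phi> \<and> odd (card {e \<in> Edges Q. \<not> consistent_at S Q \<Phi> e}))"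


section \<open>Local chromatic number and face subdivision\<close>

record 'v graph =
  vertices :: "'v set"
  adjacencies :: "'v set set"

definition neighbourhood :: "'v graph \<Rightarrow> 'v \<Rightarrow> 'v set" where
  "neighbourhood G v = {u \<in> vertices G. {u, v} \<in> adjacencies G}"

definition proper_coloring :: "'v graph \<Rightarrow> ('v \<Rightarrow> nat) \<Rightarrow> bool" where
  "proper_coloring G c \<longleftrightarrow>
     (\<forall>u\<in>vertices G. \<forall>v\<in>vertices G. {u, v} \<in> adjacencies G \<longrightarrow> c u \<noteq> c v)"

definition local_coloring :: "'v graph \<Rightarrow> nat \<Rightarrow> ('v \<Rightarrow> nat) \<Rightarrow> bool" where
  "local_coloring G k c \<longleftrightarrow> proper_coloring G c \<and>
     (\<forall>v\<in>vertices G. finite (c ` neighbourhood G v) \<and> card (c ` neighbourhood G v) \<le> k - 1)"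

text \<open>For finite graphs, where the minimum is attained.\<close>

definition local_chromatic_number :: "'v graph \<Rightarrow> nat" where
  "local_chromatic_number G = (LEAST k. 1 \<le> k \<and> (\<exists>c. local_coloring G k c))"

text \<open>
  \<open>T(Q)\<close> as an abstract graph: the new vertex in the face \<open>F\<close> is \<open>Inr F\<close>, and it is joined to the
  vertices on the boundary of \<open>F\<close>. Parallel edges of \<open>T(Q)\<close> are merged, which affects neither
  neighbourhoods nor colorings.
\<close>

definition face_subdivision :: "'a topology \<Rightarrow> 'a embedded_graph \<Rightarrow> ('a + 'a set) graph" where
  "face_subdivision S Q =
     \<lparr>vertices = Inl ` Verts Q \<union> Inr ` faces S Q,
      adjacencies = {Inl ` (e \<inter> Verts Q) |e. e \<in> Edges Q} \<union>
        {{Inl v, Inr F} |v F. F \<in> faces S Q \<and> v \<in> Verts Q \<inter> S frontier_of F}\<rparr>"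

end

theory Submission
  imports Defs
begin

text \<open>
  In a proper coloring of an odd quadrangulation some face has four different colors at its corners.
  This gives the theorem: the vertex of the face subdivision inside such a face sees four colors,
  whereas a local \<open>4\<close>-coloring allows it three.

  To find the face, count every step of every boundary walk as \<open>1\<close> if the color
  increases and as \<open>-1\<close> if it decreases. If no face has four colors, each face has equal colors at
  two opposite corners, so its walk contributes \<open>0\<close> (\<open>ascents_of_face\<close>) and the total is \<open>0\<close>.
  On the other hand every edge occurs exactly twice in the walks (\<open>card_sides\<close>). The two
  occurrences cancel if the edge is consistent and add up to \<open>2\<close> or \<open>-2\<close> if it breaks consistency
  (\<open>ascents_of_edge\<close>). A sum of terms \<open>\<plusminus>2\<close> vanishes only if their number is even, against the
  oddness of the quadrangulation (\<open>multicolored_face\<close>).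

  The topological content is that an edge has exactly two sides, which rests on invariance of domain. Every side
  contributes a half-disc along the edge, and half-discs of different sides overlap only in the edge. Two of
  them already form an open set around the interior of the edge, so there is no room for a third
  (\<open>no_third_side\<close>). As there are finitely many edges, there are then finitely many faces, and
  their closures together with the graph cover the surface. An inner point of an edge therefore has a
  neighbourhood covered by the edge and by the faces that have a side on it. If there were no side, an open set
  would be contained in an arc (\<open>sides_nonempty\<close>); if there were one, an open set would be modelled
  on a half-disc around a point of its rim (\<open>not_only_side\<close>).
\<close>

section \<open>Invariance of domain on surfaces\<close>

lemma surface_chart:
  assumes "surface S" "x \<in> topspace S"
  obtains U h k where "openin S U" "x \<in> U"
    "homeomorphic_maps (subtopology S U) (euclidean :: (real^2) topology) h k"
  using assms unfolding surface_def homeomorphic_space_def by metis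

text \<open>
  Openness is local, and in a chart the map becomes a continuous injection between open sets of two
  planes.
\<close>

lemma surface_invariance_of_domain:
  fixes f :: "'b::euclidean_space \<Rightarrow> 'a"
  assumes S: "surface S" and dim: "DIM('b) = 2"
    and U: "open U" and f: "continuous_map (top_of_set U) S f" and inj: "inj_on f U"
  shows "openin S (f ` U)"
proof (subst openin_subopen, intro ballI)
  fix y assume y: "y \<in> f ` U"
  then have "y \<in> topspace S"
    using f by (auto simp: continuous_map_def)
  then obtain V h k where V: "openin S V" "y \<in> V"
    and hk: "homeomorphic_maps (subtopology S V) (euclidean :: (real^2) topology) h k"
    using surface_chart[OF S] by metis
  define U' where "U' = {p \<in> U. f p \<in> V}"
  have "openin (top_of_set U) U'"
    using openin_continuous_map_preimage[OF f V(1)] by (simp add: U'_def)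
  then have "open U'"
    using U openin_open_trans by blast
  have f': "continuous_map (top_of_set U') (subtopology S V) f"
    using continuous_map_from_subtopology[OF f, of U'] 
    by (auto simp: continuous_map_in_subtopology subtopology_subtopology U'_def Int_absorb1 image_subset_iff)
  have h: "continuous_map (subtopology S V) euclidean h" and k: "continuous_map euclidean (subtopology S V) k"
    and kh: "\<And>v. v \<in> V \<Longrightarrow> k (h v) = v"
    using hk openin_subset[OF V(1)] by (auto simp: homeomorphic_maps_def)
  have "continuous_on U' (h \<circ> f)"
    using continuous_map_compose[OF f' h] by simp
  moreover have "inj_on (h \<circ> f) U'"
    using inj kh unfolding U'_def inj_on_def comp_def by (metis (mono_tags, lifting) mem_Collect_eq)
  ultimately have "open ((h \<circ> f) ` U')"
    using \<open>open U'\<close> dim by (intro invariance_of_domain_gen) auto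
  then have "openin (subtopology S V) {v \<in> topspace (subtopology S V). h v \<in> (h \<circ> f) ` U'}"
    using openin_continuous_map_preimage[OF h] by auto
  also have "{v \<in> topspace (subtopology S V). h v \<in> (h \<circ> f) ` U'} = f ` U'"
    using kh openin_subset[OF V(1)] by (auto simp: U'_def image_iff) (metis)+
  finally have "openin S (f ` U')"
    using V(1) openin_trans_full by blast
  moreover have "y \<in> f ` U'"
    using y V by (auto simp: U'_def)
  ultimately show "\<exists>T. openin S T \<and> y \<in> T \<and> T \<subseteq> f ` U"
    by (metis (no_types, lifting) U'_def image_mono mem_Collect_eq subsetI)
qed

text \<open>
  The converse direction of invariance of domain: an injection of a compact set into a Hausdorff
  space has a continuous inverse, and read in the charts of \<open>V\<close> this inverse is a continuous
  injection of open planar sets. Hence no open part of a surface is covered by an arc, nor by a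
  half-disc when a point of its rim is covered. These are the two ways in which
  an edge could have fewer than two sides.
\<close>

lemma open_preimage_of_embedded_compact:
  fixes f :: "'b::euclidean_space \<Rightarrow> 'a"
  assumes S: "surface S" and dim: "DIM('b) = 2" and K: "compact K"
    and f: "continuous_map (top_of_set K) S f" and inj: "inj_on f K"
    and V: "openin S V" "V \<subseteq> f ` K"
  shows "open {z \<in> K. f z \<in> V}"
proof (subst open_subopen, intro ballI)
  fix z assume z: "z \<in> {z \<in> K. f z \<in> V}"
  have fK: "f ` K \<subseteq> topspace S"
    using f by (auto simp: continuous_map_def)
  have "homeomorphic_map (top_of_set K) (subtopology S (f ` K)) f"
  proof (rule continuous_imp_homeomorphic_map)
    show "continuous_map (top_of_set K) (subtopology S (f ` K)) f"
      using f by (simp add: continuous_map_in_subtopology)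
    show "Hausdorff_space (subtopology S (f ` K))"
      using S by (simp add: surface_def Hausdorff_space_subtopology)
  qed (use K inj fK in \<open>auto simp: compact_space_subtopology\<close>)
  then obtain g where "homeomorphic_maps (top_of_set K) (subtopology S (f ` K)) f g"
    using homeomorphic_map_maps by blast
  then have g: "continuous_map (subtopology S (f ` K)) (top_of_set K) g"
    and gf: "\<And>z. z \<in> K \<Longrightarrow> g (f z) = z" and fg: "\<And>y. y \<in> f ` K \<Longrightarrow> f (g y) = y"
    using fK by (auto simp: homeomorphic_maps_def)
  have gV: "continuous_map (subtopology S V) euclidean g"
    using continuous_map_from_subtopology_mono[OF continuous_map_into_fulltopology[OF g] V(2)] .
  have "f z \<in> topspace S"
    using z fK by auto
  then obtain W h k where W: "openin S W" "f z \<in> W"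
    and hk: "homeomorphic_maps (subtopology S W) (euclidean :: (real^2) topology) h k"
    using surface_chart[OF S] by metis
  have k: "continuous_map euclidean (subtopology S W) k"
    and kh: "\<And>v. v \<in> W \<Longrightarrow> k (h v) = v" and hk': "\<And>y. h (k y) = y"
    using hk openin_subset[OF W(1)] by (auto simp: homeomorphic_maps_def)
  define P where "P = {y. k y \<in> V}"
  have "openin euclidean {y \<in> topspace euclidean. k y \<in> V}"
    using openin_continuous_map_preimage[OF continuous_map_into_fulltopology[OF k] V(1)] .
  then have "open P"
    by (simp add: P_def)
  have "continuous_map (top_of_set P) (subtopology S V) k"
    using continuous_map_from_subtopology[OF continuous_map_into_fulltopology[OF k]]
    by (auto simp: continuous_map_in_subtopology P_def)
  from continuous_map_compose[OF this gV] have "continuous_on P (g \<circ> k)"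
    by simp
  moreover have "inj_on (g \<circ> k) P"
  proof (rule inj_onI)
    fix p q assume "p \<in> P" "q \<in> P" "(g \<circ> k) p = (g \<circ> k) q"
    then have "k p = k q"
      using fg V(2) unfolding P_def comp_def by (metis mem_Collect_eq subsetD)
    then show "p = q"
      using hk' by metis
  qed
  ultimately have "open ((g \<circ> k) ` P)"
    using \<open>open P\<close> dim by (intro invariance_of_domain_gen) auto
  moreover have "z \<in> (g \<circ> k) ` P"
    using z W kh gf by (force simp: P_def image_iff intro!: exI[of _ "h (f z)"])
  moreover have "(g \<circ> k) ` P \<subseteq> {z \<in> K. f z \<in> V}"
    using fg V(2) gf by (auto simp: P_def)
  ultimately show "\<exists>T. open T \<and> z \<in> T \<and> T \<subseteq> {z \<in> K. f z \<in> V}"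
    by blast
qed

section \<open>The model quadrilateral\<close>

lemma cis_eq_imp_eq:
  assumes "cis s = cis t" "\<bar>s - t\<bar> < 2 * pi"
  shows "s = t"
proof -
  have "sin s = sin t \<and> cos s = cos t"
    using assms(1) by (auto simp: complex_eq_iff)
  then obtain n :: int where n: "s = t + 2 * pi * n"
    using sin_cos_eq_iff by blast
  then have "2 * pi * \<bar>real_of_int n\<bar> < 2 * pi * 1"
    using assms(2) by (simp add: abs_mult)
  then have "n = 0"
    by (subst (asm) mult_less_cancel_left_pos) auto
  then show ?thesis
    using n by simp
qed

definition arc_start :: "nat \<Rightarrow> real" where
  "arc_start i = real i * pi / 2"

lemma arc_start_0 [simp]: "arc_start 0 = 0"
  by (simp add: arc_start_def)

lemma arc_start_4: "arc_start 4 = 2 * pi"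
  by (simp add: arc_start_def)

lemma arc_start_Suc: "arc_start (Suc i) = arc_start i + pi / 2"
  by (simp add: arc_start_def algebra_simps add_divide_distrib)

lemma arc_start_mono: "i \<le> j \<Longrightarrow> arc_start i \<le> arc_start j"
  by (simp add: arc_start_def divide_right_mono)

lemma arc_start_less_Suc: "arc_start i < arc_start (Suc i)"
  by (simp add: arc_start_Suc)

lemma corner_eq_cis: "corner i = cis (arc_start i)"
  by (simp add: corner_def arc_start_def)

lemma side_eq_cis: "side i = cis ` {arc_start i .. arc_start (Suc i)}"
  by (simp add: side_def arc_start_def)

lemma compact_side: "compact (side i)"
  unfolding side_eq_cis by (intro compact_continuous_image continuous_intros) auto

lemma side_subset_sphere: "side i \<subseteq> sphere 0 1"
  by (auto simp: side_eq_cis)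

lemma corner_in_side: "corner i \<in> side i" "corner (Suc i) \<in> side i"
  by (auto simp: side_eq_cis corner_eq_cis intro!: imageI arc_start_mono)

lemma corner_4: "corner 4 = corner 0"
  by (simp add: corner_eq_cis arc_start_4)

lemma sphere_subset_sides:
  assumes "z \<in> sphere 0 1"
  obtains i where "i < 4" "z \<in> side i"
proof -
  have n: "norm z = 1"
    using assms by simp
  then have "(Re z)\<^sup>2 + (Im z)\<^sup>2 = 1"
    by (metis cmod_power2 one_power2)
  then obtain t where t: "0 \<le> t" "t < 2 * pi" "Re z = cos t" "Im z = sin t"
    using sincos_total_2pi by metis
  then have z: "z = cis t"
    by (simp add: complex_eq_iff)
  define i where "i = nat \<lfloor>t / (pi / 2)\<rfloor>"
  have i: "real i \<le> t / (pi / 2)" "t / (pi / 2) < real i + 1"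
    using t(1) unfolding i_def by (simp_all add: of_nat_nat)
  have "real i < 4"
  proof -
    have "t / (pi / 2) < 4"
      using t(2) by (simp add: field_simps)
    then show ?thesis
      using i(1) by linarith
  qed
  then have "i < 4" by linarith
  moreover have "z \<in> side i"
    unfolding z side_eq_cis using i pi_gt_zero by (intro imageI) (auto simp: arc_start_def field_simps)
  ultimately show ?thesis using that by blast
qed

lemma quarter_unique:
  assumes "i < 4" "j < 4" "arc_start i < t" "t < arc_start (Suc i)" "cis t \<in> side j"
  shows "i = j"
proof -
  obtain s where s: "arc_start j \<le> s" "s \<le> arc_start (Suc j)" "cis t = cis s"
    using assms(5) by (auto simp: side_eq_cis)
  have b: "arc_start (Suc i) \<le> 2 * pi" "arc_start (Suc j) \<le> 2 * pi"
    using arc_start_mono[of "Suc i" 4] arc_start_mono[of "Suc j" 4] assms(1,2) by (auto simp: arc_start_4)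
  moreover have "0 \<le> arc_start i" "0 \<le> arc_start j" by (auto simp: arc_start_def)
  ultimately have "\<bar>t - s\<bar> < 2 * pi"
    using assms(3,4) s by linarith
  then have ts: "t = s"
    using cis_eq_imp_eq s(3) by blast
  show ?thesis
  proof (rule ccontr)
    assume "i \<noteq> j"
    then consider "Suc i \<le> j" | "Suc j \<le> i" by linarith
    then show False
      using arc_start_mono[of "Suc i" j] arc_start_mono[of "Suc j" i] s(1,2) assms(3,4) ts
      by cases linarith+
  qed
qed

text \<open>
  The neighbourhood of the relatively open side \<open>i\<close> used for gluing: an open quarter of the disc
  with its outer arc, without the centre and the two bounding radii. The four sectors are disjoint,
  and a face map is injective on each of them, whatever corners and sides it identifies.
\<close>

definition sector :: "nat \<Rightarrow> complex set" where
  "sector i = {of_real r * cis t |r t. 0 < r \<and> r \<le> 1 \<and> arc_start i < t \<and> t < arc_start (Suc i)}"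

lemma sector_subset_cball: "sector i \<subseteq> cball 0 1"
  by (auto simp: sector_def norm_mult)

lemma sector_sphere: "sector i \<inter> sphere 0 1 = cis ` {arc_start i <..< arc_start (Suc i)}"
  by (force simp: sector_def norm_mult intro: exI[of _ 1])

lemma sector_sphere_subset_side: "sector i \<inter> sphere 0 1 \<subseteq> side i"
  unfolding sector_sphere side_eq_cis by (intro image_mono) auto

lemma polar_unique:
  assumes "of_real r * cis t = of_real r' * cis t'" "0 < r" "0 < r'"
  shows "r = r'" "cis t = cis t'"
proof -
  show r: "r = r'"
    using arg_cong[OF assms(1), of norm] assms(2,3) by (simp add: norm_mult)
  then show "cis t = cis t'"
    using assms by simp
qed

lemma sector_unique:
  assumes "i < 4" "j < 4" "z \<in> sector i" "z \<in> sector j"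
  shows "i = j"
proof -
  obtain r t where "z = of_real r * cis t" "0 < r" and t: "arc_start i < t" "t < arc_start (Suc i)"
    using assms(3) by (auto simp: sector_def)
  moreover obtain r' t' where "z = of_real r' * cis t'" "0 < r'"
    and t': "arc_start j < t'" "t' < arc_start (Suc j)"
    using assms(4) by (auto simp: sector_def)
  ultimately have "cis t = cis t'"
    using polar_unique by metis
  then have "cis t \<in> side j"
    using t' by (auto simp: side_eq_cis)
  then show ?thesis
    using quarter_unique assms(1,2) t by blast
qed

lemma inj_on_cis_quarter: "inj_on cis {arc_start i .. arc_start (Suc i)}"
proof (rule inj_onI)
  fix s t assume "s \<in> {arc_start i .. arc_start (Suc i)}" "t \<in> {arc_start i .. arc_start (Suc i)}"
    and st: "cis s = cis t"
  then have "\<bar>s - t\<bar> < 2 * pi"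
    using pi_gt_zero arc_start_Suc[of i] unfolding atLeastAtMost_iff by linarith
  then show "s = t"
    using cis_eq_imp_eq st by blast
qed

lemma corner_neq: "corner i \<noteq> corner (Suc i)"
proof
  assume "corner i = corner (Suc i)"
  then have "arc_start i = arc_start (Suc i)"
    unfolding corner_eq_cis by (intro inj_onD[OF inj_on_cis_quarter[of i]]) (auto intro: arc_start_mono)
  then show False
    using arc_start_less_Suc[of i] by simp
qed

section \<open>Faces and their boundary walks\<close>

lemma faces_avoid_graph: "F \<in> faces S Q \<Longrightarrow> F \<inter> (Verts Q \<union> \<Union>(Edges Q)) = {}"
  unfolding faces_def using connected_components_of_subset by fastforce

lemma faces_disjoint: "F \<in> faces S Q \<Longrightarrow> G \<in> faces S Q \<Longrightarrow> x \<in> F \<Longrightarrow> x \<in> G \<Longrightarrow> F = G"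
  unfolding faces_def
  using pairwiseD[OF pairwise_disjoint_connected_components_of] unfolding disjnt_def by blast

lemma Union_faces: "\<Union>(faces S Q) = topspace S - (Verts Q \<union> \<Union>(Edges Q))"
  unfolding faces_def Union_connected_components_of by auto

locale oriented_quadrangulation =
  fixes S :: "'a topology" and Q :: "'a embedded_graph" and \<Phi> :: "'a set \<Rightarrow> complex \<Rightarrow> 'a"
  assumes surface: "surface S"
    and embedded: "embedded_on S Q"
    and orientation: "face_orientation S Q \<Phi>"
begin

abbreviation sides_of :: "'a set \<Rightarrow> ('a set \<times> nat) set" where
  "sides_of e \<equiv> edge_sides S Q \<Phi> e"

lemma distinct_edges_meet_in_vertices:
  "e \<in> Edges Q \<Longrightarrow> e' \<in> Edges Q \<Longrightarrow> e \<noteq> e' \<Longrightarrow> e \<inter> e' \<subseteq> Verts Q"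
  using embedded unfolding embedded_on_def by metis

lemma face_map:
  assumes "F \<in> faces S Q"
  shows "continuous_map (top_of_set (cball 0 1)) S (\<Phi> F)"
    and "\<Phi> F ` ball 0 1 = F" and "inj_on (\<Phi> F) (ball 0 1)"
    and "\<And>i. i < 4 \<Longrightarrow> \<Phi> F (corner i) \<in> Verts Q"
    and "\<And>i. i < 4 \<Longrightarrow> inj_on (\<Phi> F) (side i)"
    and "\<And>i. i < 4 \<Longrightarrow> \<Phi> F ` side i \<in> Edges Q"
proof -
  have q: "quad_map S Q F (\<Phi> F)"
    using orientation assms by (simp add: face_orientation_def)
  then have hom: "homeomorphic_map (top_of_set (ball 0 1)) (subtopology S F) (\<Phi> F)"
    by (simp add: quad_map_def)
  have "F \<subseteq> topspace S"
    using assms Union_faces[of S Q] by blast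
  then show "\<Phi> F ` ball 0 1 = F" "inj_on (\<Phi> F) (ball 0 1)"
    using homeomorphic_imp_surjective_map[OF hom] homeomorphic_imp_injective_map[OF hom]
    by (auto simp: Int_absorb1)
qed (use orientation assms in \<open>auto simp: face_orientation_def quad_map_def\<close>)

lemma face_map_corner_Suc: "F \<in> faces S Q \<Longrightarrow> i < 4 \<Longrightarrow> \<Phi> F (corner (Suc i)) \<in> Verts Q"
  using face_map(4)[of F "Suc i"] face_map(4)[of F 0] corner_4
  by (cases "Suc i = 4") (auto simp: numeral_eq_Suc)

lemma edge_ends:
  assumes "F \<in> faces S Q" "i < 4"
  shows "\<Phi> F ` side i \<inter> Verts Q = {\<Phi> F (corner i), \<Phi> F (corner (Suc i))}"
    and "\<Phi> F (corner i) \<noteq> \<Phi> F (corner (Suc i))"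
proof -
  show ne: "\<Phi> F (corner i) \<noteq> \<Phi> F (corner (Suc i))"
    using face_map(5)[OF assms] corner_in_side corner_neq by (metis inj_onD)
  obtain a b where ab: "\<Phi> F ` side i \<inter> Verts Q = {a, b}"
    using embedded face_map(6)[OF assms] unfolding embedded_on_def by metis
  have "\<Phi> F (corner i) \<in> {a, b}" "\<Phi> F (corner (Suc i)) \<in> {a, b}"
    using face_map(4)[OF assms] face_map_corner_Suc[OF assms] corner_in_side unfolding ab[symmetric] by auto
  then show "\<Phi> F ` side i \<inter> Verts Q = {\<Phi> F (corner i), \<Phi> F (corner (Suc i))}"
    using ne ab by auto
qed

lemma open_arc_not_vertex:
  assumes "F \<in> faces S Q" "i < 4" "z \<in> sector i" "z \<in> sphere 0 1"
  shows "\<Phi> F z \<in> \<Phi> F ` side i - Verts Q"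
proof -
  have zi: "z \<in> side i"
    using assms(3,4) sector_sphere_subset_side by blast
  have "z \<in> cis ` {arc_start i <..< arc_start (Suc i)}"
    using assms(3,4) sector_sphere by blast
  then obtain t where t: "z = cis t" "arc_start i < t" "t < arc_start (Suc i)"
    by auto
  have "z \<noteq> corner i" "z \<noteq> corner (Suc i)"
    using inj_onD[OF inj_on_cis_quarter[of i], of t "arc_start i"]
      inj_onD[OF inj_on_cis_quarter[of i], of t "arc_start (Suc i)"] t
    by (auto simp: corner_eq_cis)
  then have "\<Phi> F z \<noteq> \<Phi> F (corner i)" "\<Phi> F z \<noteq> \<Phi> F (corner (Suc i))"
    using inj_onD[OF face_map(5)[OF assms(1,2)]] zi corner_in_side by metis+
  then show ?thesis
    using edge_ends(1)[OF assms(1,2)] zi by blast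
qed

text \<open>
  Corners are mapped to vertices, so a point of a side whose image is not a vertex lies in the
  relatively open side.
\<close>

lemma edge_point_in_sector:
  assumes "F \<in> faces S Q" "i < 4" "z \<in> side i" "\<Phi> F z \<notin> Verts Q"
  shows "z \<in> sector i"
proof -
  obtain t where t: "z = cis t" "arc_start i \<le> t" "t \<le> arc_start (Suc i)"
    using assms(3) by (auto simp: side_eq_cis)
  have "t \<noteq> arc_start i" "t \<noteq> arc_start (Suc i)"
    using assms(4) face_map(4)[OF assms(1,2)] face_map_corner_Suc[OF assms(1,2)] t(1)
    by (auto simp: corner_eq_cis)
  with t have "z \<in> cis ` {arc_start i <..< arc_start (Suc i)}"
    using t by auto
  then show ?thesis
    using sector_sphere by blast
qed

text \<open>
  Interior points of faces lie off the graph, and different edges meet in vertices only. Hence a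
  face whose closure reaches an inner point of \<open>e\<close> has a side on \<open>e\<close>.
\<close>

lemma side_of_edge_point:
  assumes "F \<in> faces S Q" "z \<in> cball 0 1" "\<Phi> F z \<in> e - Verts Q" "e \<in> Edges Q"
  obtains i where "(F, i) \<in> sides_of e" "z \<in> side i"
proof -
  have "z \<notin> ball 0 1"
    using face_map(2)[OF assms(1)] faces_avoid_graph[OF assms(1)] assms(3,4) by blast
  then have "z \<in> sphere 0 1"
    using assms(2) by auto
  then obtain i where i: "i < 4" "z \<in> side i"
    by (rule sphere_subset_sides)
  have "\<Phi> F ` side i = e"
  proof (rule ccontr)
    assume "\<Phi> F ` side i \<noteq> e"
    then have "\<Phi> F ` side i \<inter> e \<subseteq> Verts Q"
      using distinct_edges_meet_in_vertices[OF face_map(6)[OF assms(1) i(1)] assms(4)] by simp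
    then show False
      using i(2) assms(3) by blast
  qed
  then show ?thesis
    using that i assms(1) by (simp add: edge_sides_def)
qed

text \<open>
  Different sides belong to different faces or to disjoint sectors of one face, so their half-discs
  can meet only along edges. The half-discs of two sides of an edge can therefore be glued
  along the edge without any overlap.
\<close>

lemma sector_images_disjoint:
  assumes "F \<in> faces S Q" "i < 4" "G \<in> faces S Q" "j < 4" "(F, i) \<noteq> (G, j)"
    and z: "z \<in> sector i" and w: "w \<in> sector j" "w \<in> ball 0 1"
  shows "\<Phi> F z \<noteq> \<Phi> G w"
proof
  assume eq: "\<Phi> F z = \<Phi> G w"
  then have G: "\<Phi> F z \<in> G"
    using face_map(2)[OF assms(3)] w(2) by auto
  have "z \<notin> sphere 0 1"
    using open_arc_not_vertex[OF assms(1,2) z] face_map(6)[OF assms(1,2)] faces_avoid_graph[OF assms(3)] G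
    by blast
  then have zb: "z \<in> ball 0 1"
    using z sector_subset_cball by force
  then have "F = G"
    using faces_disjoint[OF assms(1,3) _ G] face_map(2)[OF assms(1)] by blast
  then have "z = w"
    using eq zb w(2) face_map(3)[OF assms(1)] by (metis inj_onD)
  then show False
    using sector_unique[OF assms(2,4) z] w(1) \<open>F = G\<close> assms(5) by blast
qed

lemma inj_on_sector:
  assumes "F \<in> faces S Q" "i < 4"
  shows "inj_on (\<Phi> F) (sector i)"
proof (rule inj_onI)
  fix z w assume z: "z \<in> sector i" and w: "w \<in> sector i" and eq: "\<Phi> F z = \<Phi> F w"
  have *: "u \<in> sphere 0 1 \<and> u \<in> side i \<and> \<Phi> F u \<in> \<Union>(Edges Q) \<or> u \<in> ball 0 1 \<and> \<Phi> F u \<in> F" if "u \<in> sector i" for u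
  proof (cases "u \<in> sphere 0 1")
    case True
    then show ?thesis
      using that sector_sphere_subset_side[of i] face_map(6)[OF assms] by blast
  next
    case False
    then have "u \<in> ball 0 1"
      using that sector_subset_cball[of i] by force
    then show ?thesis
      using face_map(2)[OF assms(1)] by blast
  qed
  show "z = w"
    using *[OF z] *[OF w] eq faces_avoid_graph[OF assms(1)] inj_onD[OF face_map(5)[OF assms] eq]
      inj_onD[OF face_map(3)[OF assms(1)] eq] by auto
qed

lemma Hausdorff: "Hausdorff_space S"
  using surface by (simp add: surface_def)

section \<open>No edge has three sides\<close>

text \<open>
  Two sides of an edge fit together to a neighbourhood of its interior: the open strip
  \<open>(-1, 1) \<times> I\<close> is mapped injectively, with its upper half going to one sector and its lower half
  to the other one. The reparametrization \<open>h\<close> matches the two parametrizations of \<open>e\<close>, so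
  that the halves agree on the middle line. Invariance of domain makes the image open.
\<close>

lemma glued_sectors:
  assumes F: "(F, i) \<in> sides_of e" and G: "(G, j) \<in> sides_of e" and ne: "(F, i) \<noteq> (G, j)"
  obtains W where "openin S W" "\<Phi> F ` sector i \<subseteq> W" "W \<subseteq> \<Phi> F ` sector i \<union> \<Phi> G ` sector j"
proof -
  have Ff: "F \<in> faces S Q" "i < 4" and Gf: "G \<in> faces S Q" "j < 4"
    and e: "\<Phi> F ` side i = e" "\<Phi> G ` side j = e"
    using F G by (auto simp: edge_sides_def)
  define I where "I = {arc_start i <..< arc_start (Suc i)}"
  define J where "J = {arc_start j .. arc_start (Suc j)}"
  have contF: "continuous_map (top_of_set (cball 0 1)) S (\<Phi> F)"
    and contG: "continuous_map (top_of_set (cball 0 1)) S (\<Phi> G)"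
    using face_map(1) Ff Gf by auto
  have "homeomorphic_map (top_of_set J) (subtopology S e) (\<Phi> G \<circ> cis)"
  proof (rule continuous_imp_homeomorphic_map)
    have im: "(\<Phi> G \<circ> cis) ` J = e"
      using e(2) by (simp add: side_eq_cis J_def image_comp)
    have "continuous_map (top_of_set J) (top_of_set (cball 0 1)) cis"
      by (auto simp: continuous_map_in_subtopology intro!: continuous_intros)
    then have c: "continuous_map (top_of_set J) S (\<Phi> G \<circ> cis)"
      using contG continuous_map_compose by blast
    then show "continuous_map (top_of_set J) (subtopology S e) (\<Phi> G \<circ> cis)"
      using im by (auto simp: continuous_map_in_subtopology)
    have "e \<subseteq> topspace S"
      using c im by (auto simp: continuous_map_def)
    then show "(\<Phi> G \<circ> cis) ` topspace (top_of_set J) = topspace (subtopology S e)"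
      using im by auto
    have "inj_on (\<Phi> G \<circ> cis) J"
      using inj_on_cis_quarter[of j] face_map(5)[OF Gf] unfolding J_def side_eq_cis by (rule comp_inj_on)
    then show "inj_on (\<Phi> G \<circ> cis) (topspace (top_of_set J))"
      by simp
    show "Hausdorff_space (subtopology S e)"
      by (rule Hausdorff_space_subtopology[OF Hausdorff])
    show "compact_space (top_of_set J)"
      by (simp add: J_def compact_space_subtopology)
  qed
  then obtain \<beta> where \<beta>: "homeomorphic_maps (top_of_set J) (subtopology S e) (\<Phi> G \<circ> cis) \<beta>"
    using homeomorphic_map_maps by blast
  have "e \<subseteq> topspace S"
    using e(1) contF side_subset_sphere[of i] by (force simp: continuous_map_def)
  then have \<beta>c: "continuous_map (subtopology S e) (top_of_set J) \<beta>"
    and \<beta>inv: "\<And>x. x \<in> e \<Longrightarrow> \<Phi> G (cis (\<beta> x)) = x"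
    using \<beta> by (auto simp: homeomorphic_maps_def)
  \<comment> \<open>The transition between the angle at which \<open>\<Phi> F\<close> passes a point of \<open>e\<close> and the one at which \<open>\<Phi> G\<close> does.\<close>
  define h where "h = \<beta> \<circ> (\<Phi> F \<circ> cis)"
  have "continuous_map (top_of_set I) (top_of_set (cball 0 1)) cis"
    by (auto simp: continuous_map_in_subtopology intro!: continuous_intros)
  then have "continuous_map (top_of_set I) S (\<Phi> F \<circ> cis)"
    using contF continuous_map_compose by blast
  moreover have Ie: "\<Phi> F (cis t) \<in> e - Verts Q" if "t \<in> I" for t
    using open_arc_not_vertex[OF Ff, of "cis t"] sector_sphere[of i] that e(1) unfolding I_def by blast
  ultimately have "continuous_map (top_of_set I) (subtopology S e) (\<Phi> F \<circ> cis)"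
    by (auto simp: continuous_map_in_subtopology)
  then have hJ: "continuous_map (top_of_set I) (top_of_set J) h"
    unfolding h_def using \<beta>c continuous_map_compose by blast
  then have hc: "continuous_on I h"
    by (simp add: continuous_map_in_subtopology)
  have Gh: "\<Phi> G (cis (h t)) = \<Phi> F (cis t)" if "t \<in> I" for t
    using \<beta>inv Ie[OF that] by (simp add: h_def)
  have hS: "cis (h t) \<in> sector j" if t: "t \<in> I" for t
  proof (rule edge_point_in_sector[OF Gf])
    have "h t \<in> J"
      using hJ t by (auto simp: continuous_map_def)
    then show "cis (h t) \<in> side j"
      by (auto simp: side_eq_cis J_def)
    show "\<Phi> G (cis (h t)) \<notin> Verts Q"
      using Gh[OF t] Ie[OF t] by simp
  qed
  have hr: "of_real r * cis (h t) \<in> sector j" if "t \<in> I" "0 < r" "r \<le> 1" for t r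
  proof -
    have "cis (h t) \<in> cis ` {arc_start j <..< arc_start (Suc j)}"
      using hS[OF that(1)] sector_sphere[of j] by fastforce
    then obtain s where "cis (h t) = cis s" "arc_start j < s" "s < arc_start (Suc j)"
      by auto
    then show ?thesis
      using that unfolding sector_def by auto
  qed
  define U where "U = {-1<..<1::real} \<times> I"
  define a where "a = (\<lambda>p::real \<times> real. of_real (1 - fst p) * cis (snd p))"
  define b where "b = (\<lambda>p::real \<times> real. of_real (1 + fst p) * cis (h (snd p)))"
  define \<Theta> where "\<Theta> = (\<lambda>p. if 0 \<le> fst p then (\<Phi> F \<circ> a) p else (\<Phi> G \<circ> b) p)"
  have a_sector: "a p \<in> sector i" if "p \<in> U" "0 \<le> fst p" for p
    unfolding sector_def a_def mem_Collect_eq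
    using that by (intro exI[of _ "1 - fst p"] exI[of _ "snd p"]) (auto simp: U_def I_def)
  have b_sector: "b p \<in> sector j" if "p \<in> U" "fst p \<le> 0" for p
    unfolding b_def using that by (intro hr) (auto simp: U_def)
  have b_ball: "b p \<in> ball 0 1" if "p \<in> U" "fst p < 0" for p
    using that by (auto simp: b_def U_def norm_mult simp del: of_real_add)
  have "continuous_map (top_of_set U) S \<Theta>"
    unfolding \<Theta>_def
  proof (rule continuous_map_cases_le)
    let ?P = "subtopology (top_of_set U) {x \<in> topspace (top_of_set U). 0 \<le> fst x}"
    have P: "?P = top_of_set {x \<in> U. 0 \<le> fst x}"
      by (auto simp: subtopology_subtopology intro: arg_cong)
    have "continuous_map ?P (top_of_set (cball 0 1)) a"
      unfolding P using a_sector sector_subset_cball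
      by (auto simp: continuous_map_in_subtopology a_def intro!: continuous_intros)
    then show "continuous_map ?P S (\<Phi> F \<circ> a)"
      using contF continuous_map_compose by blast
    let ?N = "subtopology (top_of_set U) {x \<in> topspace (top_of_set U). fst x \<le> 0}"
    have N: "?N = top_of_set {x \<in> U. fst x \<le> 0}"
      by (auto simp: subtopology_subtopology intro: arg_cong)
    have "continuous_on {x \<in> U. fst x \<le> 0} (\<lambda>p. h (snd p))"
      by (rule continuous_on_compose2[OF hc]) (auto simp: U_def intro!: continuous_intros)
    then have "continuous_map ?N (top_of_set (cball 0 1)) b"
      unfolding N using b_sector sector_subset_cball
      by (auto simp: continuous_map_in_subtopology b_def intro!: continuous_intros)
    then show "continuous_map ?N S (\<Phi> G \<circ> b)"
      using contG continuous_map_compose by blast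
    show "(\<Phi> F \<circ> a) p = (\<Phi> G \<circ> b) p" if "p \<in> topspace (top_of_set U)" "0 = fst p" for p
      using that Gh[of "snd p"] by (auto simp: a_def b_def U_def)
  qed (auto intro!: continuous_intros)
  moreover have "inj_on \<Theta> U"
  proof -
    have mixed: "\<Theta> p \<noteq> \<Theta> q" if "p \<in> U" "q \<in> U" "0 \<le> fst p" "fst q < 0" for p q
      using sector_images_disjoint[OF Ff Gf ne a_sector b_sector b_ball, of p q] that
      by (simp add: \<Theta>_def)
    have pos: "p = q" if "p \<in> U" "q \<in> U" "0 \<le> fst p" "0 \<le> fst q" "\<Theta> p = \<Theta> q" for p q
    proof -
      have "a p = a q"
        using inj_onD[OF inj_on_sector[OF Ff]] a_sector that by (simp add: \<Theta>_def)
      then have 1: "1 - fst p = 1 - fst q" "cis (snd p) = cis (snd q)"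
        using polar_unique[of "1 - fst p" "snd p" "1 - fst q" "snd q"] that by (auto simp: a_def U_def)
      then have "snd p = snd q"
        using inj_onD[OF inj_on_cis_quarter[of i] 1(2)] that by (auto simp: U_def I_def)
      then show ?thesis
        using 1 by (simp add: prod_eq_iff)
    qed
    have neg: "p = q" if "p \<in> U" "q \<in> U" "fst p < 0" "fst q < 0" "\<Theta> p = \<Theta> q" for p q
    proof -
      have "b p = b q"
        using inj_onD[OF face_map(3)[OF Gf(1)]] b_ball that by (simp add: \<Theta>_def)
      then have 1: "1 + fst p = 1 + fst q" "cis (h (snd p)) = cis (h (snd q))"
        using polar_unique[of "1 + fst p" "h (snd p)" "1 + fst q" "h (snd q)"] that by (auto simp: b_def U_def)
      then have "\<Theta> (0, snd p) = \<Theta> (0, snd q)"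
        using Gh[of "snd p"] Gh[of "snd q"] that by (auto simp: \<Theta>_def a_def U_def)
      then have "snd p = snd q"
        using pos[of "(0, snd p)" "(0, snd q)"] that by (auto simp: U_def)
      then show ?thesis
        using 1 by (simp add: prod_eq_iff)
    qed
    show ?thesis
    proof (rule inj_onI)
      fix p q assume "p \<in> U" "q \<in> U" "\<Theta> p = \<Theta> q"
      then show "p = q"
        using mixed[of p q] mixed[of q p] pos neg by (metis not_le)
    qed
  qed
  moreover have "open U"
    by (auto simp: U_def I_def intro: open_Times)
  ultimately have "openin S (\<Theta> ` U)"
    by (intro surface_invariance_of_domain[OF surface]) auto
  moreover have "\<Phi> F ` sector i \<subseteq> \<Theta> ` U"
  proof clarify
    fix z assume "z \<in> sector i"
    then obtain r t where rt: "z = of_real r * cis t" "0 < r" "r \<le> 1" "t \<in> I"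
      by (auto simp: sector_def I_def)
    then have "\<Phi> F z = \<Theta> (1 - r, t)" "(1 - r, t) \<in> U"
      by (auto simp: \<Theta>_def a_def U_def)
    then show "\<Phi> F z \<in> \<Theta> ` U" by blast
  qed
  moreover have "\<Theta> ` U \<subseteq> \<Phi> F ` sector i \<union> \<Phi> G ` sector j"
    using a_sector b_sector by (force simp: \<Theta>_def)
  ultimately show ?thesis
    using that by blast
qed

text \<open>
  A third half-disc would enter the open set glued from the first two at an inner point of the edge,
  and immediately off the edge it would have to overlap one of them.
\<close>

lemma no_third_side:
  assumes F: "(F, i) \<in> sides_of e" and G: "(G, j) \<in> sides_of e" and H: "(H, k) \<in> sides_of e"
    and ne: "(F, i) \<noteq> (G, j)" "(F, i) \<noteq> (H, k)" "(G, j) \<noteq> (H, k)"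
  shows False
proof -
  have Ff: "F \<in> faces S Q" "i < 4" and Gf: "G \<in> faces S Q" "j < 4" and Hf: "H \<in> faces S Q" "k < 4"
    and e: "\<Phi> F ` side i = e" "\<Phi> H ` side k = e"
    using F G H by (auto simp: edge_sides_def)
  obtain W where W: "openin S W" "\<Phi> F ` sector i \<subseteq> W" "W \<subseteq> \<Phi> F ` sector i \<union> \<Phi> G ` sector j"
    using glued_sectors[OF F G ne(1)] .
  obtain t0 where "arc_start i < t0" "t0 < arc_start (Suc i)"
    using dense[OF arc_start_less_Suc] by blast
  then have t0: "cis t0 \<in> sector i" "cis t0 \<in> sphere 0 1"
    using sector_sphere[of i] by auto
  then have "\<Phi> F (cis t0) \<in> e - Verts Q"
    using open_arc_not_vertex[OF Ff] e by blast
  then obtain w where w: "w \<in> side k" "\<Phi> H w = \<Phi> F (cis t0)" "\<Phi> H w \<notin> Verts Q"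
    using e(2) by (metis DiffE imageE)
  then have wk: "w \<in> sector k" "w \<in> sphere 0 1"
    using edge_point_in_sector[OF Hf] side_subset_sphere by blast+
  then have "w \<in> cis ` {arc_start k <..< arc_start (Suc k)}"
    using sector_sphere by blast
  then obtain t where t: "w = cis t" "arc_start k < t" "t < arc_start (Suc k)"
    by auto
  have "openin (top_of_set (cball 0 1)) {z \<in> cball 0 1. \<Phi> H z \<in> W}"
    using openin_continuous_map_preimage[OF face_map(1)[OF Hf(1)] W(1)] by simp
  moreover have "w \<in> {z \<in> cball 0 1. \<Phi> H z \<in> W}"
    using w(2) W(2) t0(1) wk by auto
  ultimately obtain \<epsilon> where \<epsilon>: "0 < \<epsilon>" "\<And>z. z \<in> cball 0 1 \<Longrightarrow> dist z w < \<epsilon> \<Longrightarrow> \<Phi> H z \<in> W"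
    unfolding openin_euclidean_subtopology_iff by (metis (no_types, lifting) mem_Collect_eq)
  define s where "s = min \<epsilon> 1 / 2"
  have s: "0 < s" "s < 1" "s < \<epsilon>"
    using \<epsilon>(1) by (auto simp: s_def min_def)
  \<comment> \<open>A point of the third half-disc off the edge, so close to \<open>w\<close> that its image is in \<open>W\<close>.\<close>
  define z where "z = of_real (1 - s) * cis t"
  have "z - w = - of_real s * cis t"
    by (simp add: z_def t(1) algebra_simps)
  then have "dist z w < \<epsilon>"
    using s by (simp add: dist_norm norm_mult)
  moreover have zb: "z \<in> ball 0 1"
    using s by (simp add: z_def norm_mult del: of_real_diff)
  ultimately have "\<Phi> H z \<in> W"
    using \<epsilon>(2) by force
  moreover have "z \<in> sector k"
    unfolding sector_def z_def mem_Collect_eq using s t by (intro exI[of _ "1 - s"] exI[of _ t]) auto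
  then have "\<Phi> H z \<notin> \<Phi> F ` sector i" "\<Phi> H z \<notin> \<Phi> G ` sector j"
    using sector_images_disjoint[OF Ff Hf ne(2) _ _ zb] sector_images_disjoint[OF Gf Hf ne(3) _ _ zb]
    by (metis imageE)+
  ultimately show False
    using W(3) by blast
qed

lemma card_sides_le_2: "finite (sides_of e) \<and> card (sides_of e) \<le> 2"
proof (rule ccontr)
  assume "\<not> ?thesis"
  then have "infinite (sides_of e) \<or> 3 \<le> card (sides_of e)"
    by auto
  then have "\<exists>T \<subseteq> sides_of e. card T = 3"
  proof
    assume "infinite (sides_of e)"
    then show ?thesis
      using infinite_arbitrarily_large by blast
  next
    assume "3 \<le> card (sides_of e)"
    then show ?thesis
      by (rule obtain_subset_with_card_n) blast
  qed
  then obtain T where "T \<subseteq> sides_of e" "card T = 3"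
    by blast
  moreover from this obtain x y z where "T = {x, y, z}" "x \<noteq> y" "x \<noteq> z" "y \<noteq> z"
    unfolding card_3_iff by metis
  ultimately have xyz: "x \<in> sides_of e" "y \<in> sides_of e" "z \<in> sides_of e" "x \<noteq> y" "x \<noteq> z" "y \<noteq> z"
    by blast+
  then show False
    using no_third_side[of "fst x" "snd x" e "fst y" "snd y" "fst z" "snd z"] by simp
qed

text \<open>
  There are finitely many edges, each with at most two sides, and every face has a side. That every
  edge has at least two sides relies on this: finitely many closed faces have a closed union.
\<close>

lemma finite_faces: "finite (faces S Q)"
proof (rule finite_subset)
  show "faces S Q \<subseteq> fst ` (\<Union>e\<in>Edges Q. sides_of e)"
  proof
    fix F assume F: "F \<in> faces S Q"
    then have "(F, 0) \<in> sides_of (\<Phi> F ` side 0)" "\<Phi> F ` side 0 \<in> Edges Q"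
      using face_map(6)[OF F, of 0] by (auto simp: edge_sides_def)
    then show "F \<in> fst ` (\<Union>e\<in>Edges Q. sides_of e)"
      by force
  qed
  show "finite (fst ` (\<Union>e\<in>Edges Q. sides_of e))"
    using embedded card_sides_le_2 by (auto simp: embedded_on_def)
qed

section \<open>Every edge has two sides\<close>

lemma closed_face_image: 
  assumes "F \<in> faces S Q" "compact C" "C \<subseteq> cball 0 1"
  shows "closedin S (\<Phi> F ` C)"
proof -
  have "compactin (top_of_set (cball 0 1)) C"
    using assms(2,3) by (simp add: compactin_subtopology)
  then show ?thesis
    using image_compactin[OF _ face_map(1)[OF assms(1)]] compactin_imp_closedin[OF Hausdorff] by blast
qed

lemma edge_arc:
  assumes "e \<in> Edges Q"
  obtains g where "continuous_map (top_of_set {0..1}) S g" "inj_on g {0..1}" "e = g ` {0..1::real}"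
    "g (1/2) \<in> e - Verts Q"
proof -
  obtain a b where ab: "arc_between S a b e" "e \<inter> Verts Q = {a, b}"
    using embedded assms unfolding embedded_on_def by metis
  then obtain g where g: "pathin S g" "inj_on g {0..1}" "g 0 = a" "g 1 = b" "e = g ` {0..1}"
    unfolding arc_between_def by blast
  have "g (1/2) \<noteq> g 0" "g (1/2) \<noteq> g 1"
    using inj_onD[OF g(2), of "1/2" 0] inj_onD[OF g(2), of "1/2" 1] by auto
  moreover have "g (1/2) \<in> e"
    using g(5) by auto
  ultimately have "g (1/2) \<in> e - Verts Q"
    using ab(2) g(3,4) by blast
  then show ?thesis
    using that g by (simp add: pathin_def)
qed

lemma edge_subset_topspace:
  assumes "e \<in> Edges Q"
  shows "e \<subseteq> topspace S"
proof -
  obtain g where "continuous_map (top_of_set {0..1}) S g" "e = g ` {0..1::real}"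
    using edge_arc[OF assms] by metis
  then show ?thesis
    using continuous_map_image_subset_topspace by fastforce
qed

text \<open>
  The vertices, the other edges and the closures of the faces without a side on \<open>e\<close> are finitely
  many closed sets that miss \<open>x\<close>.
\<close>

lemma edge_neighbourhood:
  assumes e: "e \<in> Edges Q" and x: "x \<in> e - Verts Q"
  obtains V where "openin S V" "x \<in> V" "V \<subseteq> e \<union> \<Union>(fst ` sides_of e)"
proof -
  define Gs where "Gs = faces S Q - fst ` sides_of e"
  define Z where "Z = Verts Q \<union> \<Union>(Edges Q - {e}) \<union> (\<Union>G\<in>Gs. \<Phi> G ` cball 0 1)"
  have "closedin S (Verts Q)"
    using embedded by (intro closedin_Hausdorff_finite[OF Hausdorff]) (simp_all add: embedded_on_def)
  moreover have "closedin S (\<Union>(Edges Q - {e}))"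
  proof (rule closedin_Union)
    show "closedin S e'" if "e' \<in> Edges Q - {e}" for e'
    proof -
      have "e' \<in> Edges Q"
        using that by blast
      then obtain g where g: "continuous_map (top_of_set {0..1}) S g" "e' = g ` {0..1::real}"
        using edge_arc by metis
      then have "compactin S e'"
        using image_compactin[of "top_of_set {0..1}" "{0..1}" S g] by (simp add: compactin_subtopology)
      then show ?thesis
        using compactin_imp_closedin[OF Hausdorff] by blast
    qed
  qed (use embedded in \<open>auto simp: embedded_on_def\<close>)
  moreover have "closedin S (\<Union>G\<in>Gs. \<Phi> G ` cball 0 1)"
    by (rule closedin_Union) (use finite_faces closed_face_image in \<open>auto simp: Gs_def\<close>)
  ultimately have "closedin S Z"
    unfolding Z_def by (intro closedin_Un)
  then have "openin S (topspace S - Z)"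
    by blast
  moreover have "x \<in> topspace S - Z"
  proof -
    have "x \<notin> \<Union>(Edges Q - {e})"
      using x distinct_edges_meet_in_vertices[OF e] by blast
    moreover have "x \<notin> \<Phi> G ` cball 0 1" if "G \<in> Gs" for G
    proof
      assume "x \<in> \<Phi> G ` cball 0 1"
      then obtain z where "z \<in> cball 0 1" "x = \<Phi> G z"
        by blast
      moreover have "G \<in> faces S Q"
        using that by (simp add: Gs_def)
      ultimately obtain i where "(G, i) \<in> sides_of e"
        using side_of_edge_point[of G z e] x e by metis
      then have "G \<in> fst ` sides_of e"
        by force
      then show False
        using that by (simp add: Gs_def)
    qed
    moreover have "x \<in> topspace S"
      using x edge_subset_topspace[OF e] by blast
    ultimately show ?thesis
      using x by (auto simp: Z_def)
  qed
  moreover have "topspace S - Z \<subseteq> e \<union> \<Union>(fst ` sides_of e)"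
  proof
    fix y assume y: "y \<in> topspace S - Z"
    show "y \<in> e \<union> \<Union>(fst ` sides_of e)"
    proof (cases "y \<in> e")
      case False
      then have "y \<in> topspace S - (Verts Q \<union> \<Union>(Edges Q))"
        using y by (auto simp: Z_def)
      then obtain G where G: "G \<in> faces S Q" "y \<in> G"
        unfolding Union_faces[symmetric] by blast
      then have "y \<in> \<Phi> G ` cball 0 1"
        using face_map(2)[OF G(1)] ball_subset_cball by blast
      then have "G \<notin> Gs"
        using y by (auto simp: Z_def)
      then show ?thesis
        using G by (auto simp: Gs_def)
    qed simp
  qed
  ultimately show ?thesis
    using that by blast
qed

text \<open>
  Otherwise an open part of the surface would be contained in the edge, hence an open subset of the
  plane in a line.
\<close>

lemma sides_nonempty:
  assumes e: "e \<in> Edges Q"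
  shows "sides_of e \<noteq> {}"
proof
  assume none: "sides_of e = {}"
  obtain g where g: "continuous_map (top_of_set {0..1}) S g" "inj_on g {0..1}" "e = g ` {0..1::real}"
    "g (1/2) \<in> e - Verts Q"
    using edge_arc[OF e] .
  obtain V where V: "openin S V" "g (1/2) \<in> V" "V \<subseteq> e"
    using edge_neighbourhood[OF e g(4)] none by auto
  define K where "K = complex_of_real ` {0..1}"
  have "open {z \<in> K. (g \<circ> Re) z \<in> V}"
  proof (rule open_preimage_of_embedded_compact[OF surface])
    show "compact K"
      unfolding K_def by (intro compact_continuous_image continuous_intros) auto
    have "continuous_map (top_of_set K) (top_of_set {0..1}) Re"
      by (auto simp: continuous_map_in_subtopology K_def intro!: continuous_intros)
    then show "continuous_map (top_of_set K) S (g \<circ> Re)"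
      using g(1) continuous_map_compose by blast
    show "inj_on (g \<circ> Re) K"
      using g(2) by (auto simp: K_def inj_on_def)
    show "V \<subseteq> (g \<circ> Re) ` K"
      using V(3) g(3) by (auto simp: K_def image_comp)
  qed (auto simp: V)
  moreover have "1/2 \<in> {z \<in> K. (g \<circ> Re) z \<in> V}"
    using V(2) by (auto simp: K_def image_iff intro!: bexI[of _ "1/2"])
  ultimately obtain \<epsilon> where \<epsilon>: "0 < \<epsilon>" "ball (1/2) \<epsilon> \<subseteq> {z \<in> K. (g \<circ> Re) z \<in> V}"
    unfolding open_contains_ball by blast
  have "1/2 + of_real (\<epsilon>/2) * \<i> \<in> ball (1/2) \<epsilon>"
    using \<epsilon>(1) by (simp add: dist_norm norm_mult)
  then have "1/2 + of_real (\<epsilon>/2) * \<i> \<in> K"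
    using \<epsilon>(2) by blast
  then have "Im (1/2 + of_real (\<epsilon>/2) * \<i>) = 0"
    unfolding K_def by (metis Im_complex_of_real imageE)
  then show False
    using \<epsilon>(1) by simp
qed

text \<open>
  Otherwise the surface would have a boundary along the edge: near an inner point \<open>x\<close> of \<open>e\<close> it would
  be covered by one half-disc, injectively, with \<open>x\<close> on the rim.
\<close>

lemma not_only_side:
  assumes e: "e \<in> Edges Q"
  shows "sides_of e \<noteq> {(F, i)}"
proof
  assume one: "sides_of e = {(F, i)}"
  then have "(F, i) \<in> sides_of e"
    by simp
  then have Ff: "F \<in> faces S Q" "i < 4" and Fe: "\<Phi> F ` side i = e"
    by (simp_all add: edge_sides_def)
  obtain x where x: "x \<in> e - Verts Q"
    using edge_arc[OF e] by metis
  obtain V where V: "openin S V" "x \<in> V" "V \<subseteq> e \<union> F"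
    using edge_neighbourhood[OF e x] one by auto
  obtain z where z: "z \<in> side i" "\<Phi> F z = x"
    using x Fe by blast
  have z1: "z \<in> sphere 0 1"
    using z(1) side_subset_sphere by blast
  have only_z: "u = z" if u: "u \<in> cball 0 1" "\<Phi> F u = x" for u
  proof -
    obtain j where "(F, j) \<in> sides_of e" "u \<in> side j"
      using side_of_edge_point[OF Ff(1) u(1) _ e] u(2) x by metis
    then have "u \<in> side i"
      using one by simp
    then show ?thesis
      using z u(2) inj_onD[OF face_map(5)[OF Ff]] by blast
  qed
  define T where "T = (\<Union>j\<in>{..<4}-{i}. side j)"
  have "closed T"
    unfolding T_def by (intro closed_UN) (auto intro: compact_imp_closed compact_side)
  moreover have "z \<notin> T"
  proof
    assume "z \<in> T"
    then obtain j where j: "j < 4" "j \<noteq> i" "z \<in> side j"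
      by (auto simp: T_def)
    have "z \<in> sector i"
      using edge_point_in_sector[OF Ff z(1)] z(2) x by blast
    then have "z \<in> cis ` {arc_start i <..< arc_start (Suc i)}"
      using z1 sector_sphere by blast
    then show False
      using quarter_unique[OF Ff(2) j(1)] j by auto
  qed
  ultimately obtain \<epsilon> where \<epsilon>: "0 < \<epsilon>" "cball z \<epsilon> \<subseteq> - T"
    using open_contains_cball[of "- T"] by (auto simp: open_Compl)
  \<comment> \<open>A half-disc around \<open>z\<close> that meets no side but the \<open>i\<close>-th one, so that \<open>\<Phi> F\<close> is injective on it.\<close>
  define K where "K = cball 0 1 \<inter> cball z \<epsilon>"
  have K: "u \<in> side i \<and> \<Phi> F u \<in> \<Union>(Edges Q) \<or> u \<in> ball 0 1 \<and> \<Phi> F u \<in> F" if u: "u \<in> K" for u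
  proof (cases "u \<in> sphere 0 1")
    case True
    then obtain j where "j < 4" "u \<in> side j"
      by (rule sphere_subset_sides)
    moreover have "u \<notin> T"
      using u \<epsilon>(2) by (auto simp: K_def)
    ultimately show ?thesis
      using face_map(6)[OF Ff] by (auto simp: T_def)
  next
    case False
    then have "u \<in> ball 0 1"
      using u by (auto simp: K_def)
    then show ?thesis
      using face_map(2)[OF Ff(1)] by blast
  qed
  have injK: "inj_on (\<Phi> F) K"
  proof (rule inj_onI)
    fix u v assume "u \<in> K" "v \<in> K" and eq: "\<Phi> F u = \<Phi> F v"
    then show "u = v"
      using K[of u] K[of v] faces_avoid_graph[OF Ff(1)] inj_onD[OF face_map(5)[OF Ff] eq]
        inj_onD[OF face_map(3)[OF Ff(1)] eq] by auto
  qed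
  \<comment> \<open>The rest of the closed face stays away from \<open>x\<close>, by compactness, and can be removed from \<open>V\<close>.\<close>
  define C where "C = cball 0 1 - ball z \<epsilon>"
  have "compact C"
    unfolding C_def by (intro compact_diff) auto
  then have "closedin S (\<Phi> F ` C)"
    using closed_face_image[OF Ff(1)] by (auto simp: C_def)
  then have V': "openin S (V - \<Phi> F ` C)"
    using V(1) by (rule openin_diff[rotated])
  have "open {w \<in> K. \<Phi> F w \<in> V - \<Phi> F ` C}"
  proof (rule open_preimage_of_embedded_compact[OF surface _ _ _ injK V'])
    show "compact K"
      unfolding K_def by (intro compact_Int) auto
    show "continuous_map (top_of_set K) S (\<Phi> F)"
      using continuous_map_from_subtopology_mono[OF face_map(1)[OF Ff(1)]] by (simp add: K_def)
    have cover: "cball 0 1 \<subseteq> C \<union> K"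
      by (auto simp: K_def C_def)
    have cover: "cball 0 1 \<subseteq> C \<union> K"
      by (auto simp: K_def C_def)
    have cover: "cball 0 1 \<subseteq> C \<union> K"
      by (auto simp: K_def C_def)
    show "V - \<Phi> F ` C \<subseteq> \<Phi> F ` K"
    proof
      fix y assume y: "y \<in> V - \<Phi> F ` C"
      then have "y \<in> \<Phi> F ` cball 0 1"
        using V(3) Fe face_map(2)[OF Ff(1)] side_subset_sphere[of i] sphere_cball[of 0 1] ball_subset_cball[of 0 1]
        by blast
      then show "y \<in> \<Phi> F ` K"
        using y cover by blast
    qed
  qed simp
  moreover have "{w \<in> K. \<Phi> F w \<in> V - \<Phi> F ` C} \<subseteq> cball 0 1"
    by (auto simp: K_def)
  ultimately have "{w \<in> K. \<Phi> F w \<in> V - \<Phi> F ` C} \<subseteq> ball 0 1"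
    using interior_maximal interior_cball by metis
  moreover have "z \<in> K"
    using z1 \<epsilon>(1) by (simp add: K_def)
  moreover have "x \<notin> \<Phi> F ` C"
    using only_z \<epsilon>(1) by (auto simp: C_def)
  ultimately have "z \<in> ball 0 1"
    using z(2) V(2) by blast
  then show False
    using z1 by simp
qed

lemma card_sides:
  assumes "e \<in> Edges Q"
  shows "card (sides_of e) = 2"
proof -
  have fin: "finite (sides_of e)" and le: "card (sides_of e) \<le> 2"
    using card_sides_le_2 by auto
  have "card (sides_of e) \<noteq> 0"
    using fin sides_nonempty[OF assms] by simp
  moreover have "card (sides_of e) \<noteq> 1"
    using not_only_side[OF assms] by (auto simp: card_1_singleton_iff)
  ultimately show ?thesis
    using le by linarith
qed

section \<open>Colorings and parity\<close>

text \<open>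
  The value is \<open>1\<close> or \<open>-1\<close> on the sides of a properly colored quadrangulation: the edge is traversed
  towards the larger or towards the smaller color.
\<close>

definition ascent :: "('a \<Rightarrow> nat) \<Rightarrow> 'a set \<times> nat \<Rightarrow> int" where
  "ascent c = (\<lambda>(F, i). sgn (int (c (\<Phi> F (corner (Suc i)))) - int (c (\<Phi> F (corner i)))))"

definition proper_on_edges :: "('a \<Rightarrow> nat) \<Rightarrow> bool" where
  "proper_on_edges c \<longleftrightarrow> (\<forall>e\<in>Edges Q. inj_on c (e \<inter> Verts Q))"

lemma proper_on_side:
  assumes "proper_on_edges c" "F \<in> faces S Q" "i < 4"
  shows "c (\<Phi> F (corner i)) \<noteq> c (\<Phi> F (corner (Suc i)))"
proof -
  have "inj_on c {\<Phi> F (corner i), \<Phi> F (corner (Suc i))}"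
    using assms(1) face_map(6)[OF assms(2,3)] edge_ends(1)[OF assms(2,3)]
    unfolding proper_on_edges_def by metis
  then show ?thesis
    using edge_ends(2)[OF assms(2,3)] by (auto simp: inj_on_def)
qed

text \<open>
  Adjacent corners have different colors, so a face with a repeated color has equal colors at two
  opposite corners. These split the boundary walk into two closed walks of length two in
  the colors, and each of them goes up once and down once.
\<close>

lemma ascents_of_face:
  assumes c: "proper_on_edges c" and F: "F \<in> faces S Q"
    and few: "\<not> inj_on (\<lambda>i. c (\<Phi> F (corner i))) {..<4}"
  shows "(\<Sum>i<4. ascent c (F, i)) = 0"
proof -
  define d where "d i = c (\<Phi> F (corner i))" for i
  have d4: "d 4 = d 0"
    by (simp add: d_def corner_4)
  have "d i \<noteq> d (Suc i)" if "i < 4" for i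
    using proper_on_side[OF c F that] by (simp add: d_def)
  from this[of 0] this[of 1] this[of 2] this[of 3]
  have ne: "d 0 \<noteq> d 1" "d 1 \<noteq> d 2" "d 2 \<noteq> d 3" "d 3 \<noteq> d 0"
    using d4 by (auto simp: eval_nat_numeral)
  have eq: "d 0 = d 2 \<or> d 1 = d 3"
  proof (rule ccontr)
    assume "\<not> ?thesis"
    then have "inj_on d {0, 1, 2, 3}"
      using ne by (auto simp: inj_on_def)
    moreover have "{..<4} = {0, 1, 2, 3::nat}"
      by auto
    ultimately show False
      using few by (simp add: d_def)
  qed
  have sgn_swap: "sgn (int a - int b) = - sgn (int b - int a)" for a b
    by (simp add: sgn_if)
  have "(\<Sum>i<4. ascent c (F, i)) = sgn (int (d 1) - int (d 0)) + sgn (int (d 2) - int (d 1))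
      + sgn (int (d 3) - int (d 2)) + sgn (int (d 0) - int (d 3))"
    using d4 by (simp add: eval_nat_numeral ascent_def d_def)
  also have "\<dots> = 0"
    using eq sgn_swap[of "d 0" "d 1"] sgn_swap[of "d 0" "d 3"] sgn_swap[of "d 2" "d 1"] sgn_swap[of "d 3" "d 2"] 
    by auto
  finally show ?thesis .
qed

text \<open>
  The two sides of an edge traverse it in opposite directions if the edge is consistent and in the
  same direction otherwise.
\<close>

lemma ascents_of_edge:
  assumes c: "proper_on_edges c" and e: "e \<in> Edges Q"
  shows "consistent_at S Q \<Phi> e \<Longrightarrow> sum (ascent c) (sides_of e) = 0"
    and "\<not> consistent_at S Q \<Phi> e \<Longrightarrow> sum (ascent c) (sides_of e) \<in> {2, -2}"
proof -
  obtain F i G j where sides: "sides_of e = {(F, i), (G, j)}" and ne: "(F, i) \<noteq> (G, j)"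
    using card_sides[OF e] unfolding card_2_iff by (metis surj_pair)
  have mem: "(F, i) \<in> sides_of e" "(G, j) \<in> sides_of e"
    using sides by auto
  then have Ff: "F \<in> faces S Q" "i < 4" "\<Phi> F ` side i = e"
    and Gf: "G \<in> faces S Q" "j < 4" "\<Phi> G ` side j = e"
    by (auto simp: edge_sides_def)
  define p p' q q' where "p = \<Phi> F (corner i)" and "p' = \<Phi> F (corner (Suc i))"
    and "q = \<Phi> G (corner j)" and "q' = \<Phi> G (corner (Suc j))"
  note pq = p_def p'_def q_def q'_def
  have sum: "sum (ascent c) (sides_of e) = sgn (int (c p') - int (c p)) + sgn (int (c q') - int (c q))"
    using ne by (simp add: sides ascent_def pq)
  have cons: "consistent_at S Q \<Phi> e \<longleftrightarrow> p = q' \<and> p' = q"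
    using ne by (auto simp: consistent_at_def sides pq)
  have ends: "{p, p'} = {q, q'}" "p \<noteq> p'"
    using edge_ends[OF Ff(1,2)] edge_ends[OF Gf(1,2)] Ff(3) Gf(3) by (auto simp: pq)
  have "c p \<noteq> c p'"
    using proper_on_side[OF c Ff(1,2)] by (simp add: pq)
  then show "consistent_at S Q \<Phi> e \<Longrightarrow> sum (ascent c) (sides_of e) = 0"
    and "\<not> consistent_at S Q \<Phi> e \<Longrightarrow> sum (ascent c) (sides_of e) \<in> {2, -2}"
    using ends unfolding sum cons by (auto simp: sgn_if doubleton_eq_iff)
qed

text \<open>
  If no face had four colors, the ascents of all the sides would sum up to \<open>0\<close>. Collected edge by
  edge the sum is twice a sum of one term \<open>\<plusminus>1\<close> per inconsistent edge, and it can
  vanish only if the number of these edges is even.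
\<close>

lemma multicolored_face:
  assumes c: "proper_on_edges c"
    and odd: "odd (card {e \<in> Edges Q. \<not> consistent_at S Q \<Phi> e})"
  obtains F where "F \<in> faces S Q" "inj_on (\<lambda>i. c (\<Phi> F (corner i))) {..<4}"
proof (rule ccontr)
  assume no: "\<not> thesis"
  note [simp] = finite_faces
  have finE: "finite (Edges Q)"
    using embedded by (simp add: embedded_on_def)
  define T where "T e = sum (ascent c) (sides_of e)" for e
  have T: "T e = 0 \<and> consistent_at S Q \<Phi> e \<or> T e \<in> {2, -2} \<and> \<not> consistent_at S Q \<Phi> e"
    if "e \<in> Edges Q" for e
    using ascents_of_edge[OF c that] unfolding T_def by blast
  have "sum T (Edges Q) = (\<Sum>e\<in>Edges Q. sum (ascent c) {s \<in> faces S Q \<times> {..<4}. (\<lambda>(F, i). \<Phi> F ` side i) s = e})"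
    unfolding T_def by (intro sum.cong arg_cong[of _ _ "sum _"]) (auto simp: edge_sides_def)
  also have "\<dots> = sum (ascent c) (faces S Q \<times> {..<4})"
    using face_map(6) finE by (intro sum.group) auto
  also have "\<dots> = (\<Sum>F\<in>faces S Q. \<Sum>i<4. ascent c (F, i))"
    by (simp add: sum.cartesian_product)
  also have "\<dots> = 0"
    using ascents_of_face[OF c] no that by (intro sum.neutral) blast
  finally have "sum T (Edges Q) = 0" .
  moreover have "sum T (Edges Q) = (\<Sum>e\<in>Edges Q. 2 * (T e div 2))"
    using T by (intro sum.cong) force+
  ultimately have "(\<Sum>e\<in>Edges Q. T e div 2) = 0"
    by (simp flip: sum_distrib_left)
  then have "even (card {e \<in> Edges Q. odd (T e div 2)})"
    using even_sum_iff[OF finE, of "\<lambda>e. T e div 2"] by simp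
  also have "{e \<in> Edges Q. odd (T e div 2)} = {e \<in> Edges Q. \<not> consistent_at S Q \<Phi> e}"
    using T by fastforce
  finally show False
    using odd by simp
qed

lemma corner_in_frontier:
  assumes "F \<in> faces S Q" "i < 4"
  shows "\<Phi> F (corner i) \<in> S frontier_of F"
proof -
  have "F \<subseteq> topspace S"
    using assms(1) Union_faces[of S Q] by blast
  have ic: "corner i \<in> cball 0 1"
    by (simp add: corner_eq_cis)
  have "\<Phi> F ` (top_of_set (cball 0 1) closure_of ball 0 1) \<subseteq> S closure_of (\<Phi> F ` ball 0 1)"
    by (rule continuous_map_image_closure_subset[OF face_map(1)[OF assms(1)]])
  moreover have "corner i \<in> top_of_set (cball 0 1) closure_of ball 0 1"
    using ic by (simp add: closure_of_subtopology Int_absorb1)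
  ultimately have "\<Phi> F (corner i) \<in> S closure_of F"
    using face_map(2)[OF assms(1)] by auto
  moreover have "\<Phi> F (corner i) \<notin> F"
    using faces_avoid_graph[OF assms(1)] face_map(4)[OF assms] by blast
  then have "\<Phi> F (corner i) \<notin> S interior_of F"
    using interior_of_subset by fast
  ultimately show ?thesis
    by (simp add: frontier_of_def)
qed

lemma edge_has_two_ends:
  assumes "e \<in> Edges Q"
  obtains a b where "a \<noteq> b" "e \<inter> Verts Q = {a, b}"
proof -
  obtain a b where ab: "arc_between S a b e" "e \<inter> Verts Q = {a, b}"
    using embedded assms unfolding embedded_on_def by metis
  then obtain g where "inj_on g {0..1::real}" "g 0 = a" "g 1 = b"
    unfolding arc_between_def by blast
  moreover from this have "a \<noteq> b"
    using inj_onD[of g "{0..1}" 0 1] by auto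
  ultimately show ?thesis
    using that ab(2) by blast
qed

section \<open>The face subdivision\<close>

text \<open>
  The least number in the definition of the local chromatic number is attained only because some
  local coloring exists; on a finite graph without loops any injective coloring is one.
\<close>

lemma face_subdivision_has_local_coloring:
  "\<exists>k. 1 \<le> k \<and> (\<exists>c. local_coloring (face_subdivision S Q) k c)"
proof -
  let ?T = "face_subdivision S Q"
  have fin: "finite (vertices ?T)"
    using embedded finite_faces by (simp add: face_subdivision_def embedded_on_def)
  then obtain c :: "'a + 'a set \<Rightarrow> nat" where c: "inj_on c (vertices ?T)"
    using finite_imp_inj_to_nat_seg by metis
  have loopless: "{v, v} \<notin> adjacencies ?T" for v
  proof
    assume "{v, v} \<in> adjacencies ?T"
    then have "(\<exists>e\<in>Edges Q. {v} = Inl ` (e \<inter> Verts Q)) \<or> (\<exists>u F. {v} = {Inl u, Inr F})"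
      unfolding face_subdivision_def by fastforce
    moreover have "{v} \<noteq> {Inl u, Inr F}" for u F
      by (metis Inl_Inr_False insertI1 insertI2 singletonD)
    ultimately obtain e where e: "e \<in> Edges Q" "Inl ` (e \<inter> Verts Q) = {v}"
      by metis
    obtain a b where "a \<noteq> b" "e \<inter> Verts Q = {a, b}"
      using edge_has_two_ends[OF e(1)] .
    then have "Inl a = v" "Inl b = v"
      using e(2) by auto
    then show False
      using \<open>a \<noteq> b\<close> by blast
  qed
  have "proper_coloring ?T c"
    unfolding proper_coloring_def using c loopless by (metis inj_onD)
  moreover have "finite (c ` neighbourhood ?T v) \<and> card (c ` neighbourhood ?T v) \<le> card (vertices ?T)" for v
  proof -
    have "neighbourhood ?T v \<subseteq> vertices ?T"
      by (auto simp: neighbourhood_def)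
    then show ?thesis
      using fin by (meson card_image_le card_mono finite_imageI finite_subset le_trans)
  qed
  ultimately have "local_coloring ?T (Suc (card (vertices ?T))) c"
    by (simp add: local_coloring_def)
  then show ?thesis
    by (metis le_add1 plus_1_eq_Suc)
qed

end

theorem theorem7p1:
  fixes S :: "'a topology" and Q :: "'a embedded_graph"
  assumes "surface S" and "\<not> orientable S"
    and "quadrangulation S Q" and "odd_quadrangulation S Q"
  shows "local_chromatic_number (face_subdivision S Q) \<ge> 5"
proof (rule ccontr)
  let ?T = "face_subdivision S Q"
  assume "\<not> ?thesis"
  then have small: "local_chromatic_number ?T \<le> 4"
    by simp
  obtain \<Phi> where \<Phi>: "face_orientation S Q \<Phi>" "odd (card {e \<in> Edges Q. \<not> consistent_at S Q \<Phi> e})"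
    using assms(4) unfolding odd_quadrangulation_def by blast
  interpret oriented_quadrangulation S Q \<Phi>
    using assms(1,3) \<Phi>(1) by unfold_locales (simp_all add: quadrangulation_def)
  obtain c where "local_coloring ?T (local_chromatic_number ?T) c"
    using LeastI_ex[OF face_subdivision_has_local_coloring] unfolding local_chromatic_number_def[symmetric] by metis
  then have lc: "proper_coloring ?T c \<and> (\<forall>v\<in>vertices ?T. finite (c ` neighbourhood ?T v) \<and>
      card (c ` neighbourhood ?T v) \<le> local_chromatic_number ?T - 1)"
    unfolding local_coloring_def .
  then have proper: "proper_coloring ?T c" ..
  have "proper_on_edges (c \<circ> Inl)"
    unfolding proper_on_edges_def
  proof (intro ballI inj_onI)
    fix e u v assume e: "e \<in> Edges Q" and u: "u \<in> e \<inter> Verts Q" and v: "v \<in> e \<inter> Verts Q"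
      and eq: "(c \<circ> Inl) u = (c \<circ> Inl) v"
    show "u = v"
    proof (rule ccontr)
      assume "u \<noteq> v"
      moreover obtain a b where "e \<inter> Verts Q = {a, b}"
        using edge_has_two_ends[OF e] .
      ultimately have "e \<inter> Verts Q = {u, v}"
        using u v by auto
      then have ends: "{Inl u, Inl v} = Inl ` (e \<inter> Verts Q)"
        by simp
      have "{Inl u, Inl v} \<in> adjacencies ?T"
        unfolding ends using e by (simp add: face_subdivision_def) blast
      moreover have "Inl u \<in> vertices ?T" "Inl v \<in> vertices ?T"
        using u v by (auto simp: face_subdivision_def)
      ultimately have "c (Inl u) \<noteq> c (Inl v)"
        using proper unfolding proper_coloring_def by blast
      then show False
        using eq by simp
    qed
  qed
  then obtain F where F: "F \<in> faces S Q" and inj: "inj_on (\<lambda>i. (c \<circ> Inl) (\<Phi> F (corner i))) {..<4}"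
    using multicolored_face \<Phi>(2) by blast
  have FT: "Inr F \<in> vertices ?T"
    using F by (simp add: face_subdivision_def)
  have "Inl (\<Phi> F (corner i)) \<in> neighbourhood ?T (Inr F)" if "i < 4" for i
  proof -
    have v: "\<Phi> F (corner i) \<in> Verts Q \<inter> S frontier_of F"
      using face_map(4)[OF F that] corner_in_frontier[OF F that] by simp
    then have "{Inl (\<Phi> F (corner i)), Inr F} \<in> adjacencies ?T"
      using F by (simp add: face_subdivision_def) blast
    then show ?thesis
      using v by (simp add: neighbourhood_def face_subdivision_def)
  qed
  then have "(\<lambda>i. (c \<circ> Inl) (\<Phi> F (corner i))) ` {..<4} \<subseteq> c ` neighbourhood ?T (Inr F)"
    by auto
  moreover have "finite (c ` neighbourhood ?T (Inr F))" "card (c ` neighbourhood ?T (Inr F)) \<le> 3"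
    using bspec[OF conjunct2[OF lc] FT] small by linarith+
  ultimately have "card ((\<lambda>i. (c \<circ> Inl) (\<Phi> F (corner i))) ` {..<4}) \<le> 3"
    using card_mono le_trans by blast
  then show False
    using card_image[OF inj] by simp
qed

end
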